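(* Let $F = (F_1,\ldots,F_m) : \mathbb{C}^n \to \mathbb{C}^m$ be a polynomial map of degree $\leq 3$, and let $\beta, \gamma \in \mathbb{C}^n$ be such that $\gamma \neq 0$. If $F|_{\beta + \mathbb{C}\gamma}$ is injective and $(\mathcal{J}F)|_{X=\alpha} \cdot \gamma \neq 0$ for all $\alpha \in \{\beta + \mu\gamma \mid \mu \in \mathbb{C}\}$, then $F|_{\beta+\mathbb{C}\gamma}$ is linearly rectifiable, i.e. there exists a $v \in \mathbb{C}^m$ such that $$\sum_{j=1}^m v_j \cdot \frac{\mathrm{d}}{\mathrm{d}T}\big(F_j(\beta + T\gamma)\big) = 1$$ as an identity in $\mathbb{C}[T]$.
   Context: $\mathcal{J}F$ denotes the Jacobian matrix of $F$ with respect to the coordinates $X=(X_1,\ldots,X_n)$ (an $m\times n$ matrix of polynomials), and $(\mathcal{J}F)|_{X=\alpha}$ is its evaluation at $\alpha \in \mathbb{C}^n$. The vector $\gamma$ is regarded as a column vector. $F|_{\beta+\mathbb{C}\gamma}$ is the restriction of $F$ to the line $\{\beta+\mu\gamma\mid\mu\in\mathbb{C}\}$, and $T$ is an indeterminate. *)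

theory Defs
  imports
    "HOL-Analysis.Analysis"
    "HOL-Library.Poly_Mapping"
    "HOL-Computational_Algebra.Polynomial"
begin

text \<open>
  A polynomial in the finitely many variables \<open>X i\<close>, \<open>i :: 'n\<close>, is a finitely supported map from
  exponent vectors to coefficients; the ring structure on this type is the one of
  \<^theory>\<open>HOL-Library.Poly_Mapping\<close>, whose multiplication is convolution.
\<close>

type_synonym ('n, 'a) mpolynomial = "('n \<Rightarrow>\<^sub>0 nat) \<Rightarrow>\<^sub>0 'a"

definition monom_degree :: "('n::finite \<Rightarrow>\<^sub>0 nat) \<Rightarrow> nat" where
  "monom_degree e = (\<Sum>i\<in>UNIV. Poly_Mapping.lookup e i)"

text \<open>The zero polynomial gets total degree \<open>0\<close>.\<close>

definition total_degree :: "('n::finite, 'a::zero) mpolynomial \<Rightarrow> nat" where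
  "total_degree p = Max (insert 0 (monom_degree ` Poly_Mapping.keys p))"

definition polymap_degree :: "(('n::finite, 'a::zero) mpolynomial) ^ 'm::finite \<Rightarrow> nat" where
  "polymap_degree F = Max ((\<lambda>j. total_degree (F $ j)) ` UNIV)"

text \<open>
  Substitution of \<open>x i\<close> for the variable \<open>X i\<close>, where \<open>h\<close> embeds the coefficients into the target
  ring.
\<close>

definition mpoly_subst ::
  "('a::zero \<Rightarrow> 'b::comm_semiring_1) \<Rightarrow> ('n::finite \<Rightarrow> 'b) \<Rightarrow> ('n, 'a) mpolynomial \<Rightarrow> 'b" where
  "mpoly_subst h x p =
     (\<Sum>e\<in>Poly_Mapping.keys p.
        h (Poly_Mapping.lookup p e) * (\<Prod>i\<in>UNIV. x i ^ Poly_Mapping.lookup e i))"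

definition mpoly_eval :: "('n::finite, 'a::comm_semiring_1) mpolynomial \<Rightarrow> 'a ^ 'n \<Rightarrow> 'a" where
  "mpoly_eval p x = mpoly_subst (\<lambda>c. c) (\<lambda>i. x $ i) p"

definition polymap_eval ::
  "(('n::finite, 'a::comm_semiring_1) mpolynomial) ^ 'm::finite \<Rightarrow> 'a ^ 'n \<Rightarrow> 'a ^ 'm" where
  "polymap_eval F x = (\<chi> j. mpoly_eval (F $ j) x)"

text \<open>The univariate polynomial \<open>p(\<beta> + T\<gamma>)\<close> in the indeterminate \<open>T\<close>.\<close>

definition mpoly_on_line ::
  "('n::finite, 'a::comm_semiring_1) mpolynomial \<Rightarrow> 'a ^ 'n \<Rightarrow> 'a ^ 'n \<Rightarrow> 'a poly" where
  "mpoly_on_line p \<beta> \<gamma> = mpoly_subst (\<lambda>c. [:c:]) (\<lambda>i. [:\<beta> $ i, \<gamma> $ i:]) p"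

text \<open>
  The formal partial derivative with respect to \<open>X i\<close>. If \<open>X i\<close> does not occur in a monomial, the
  coefficient \<open>of_nat 0\<close> makes the truncated subtraction of exponents irrelevant.
\<close>

definition mpoly_pderiv ::
  "'n::finite \<Rightarrow> ('n, 'a::comm_semiring_1) mpolynomial \<Rightarrow> ('n, 'a) mpolynomial" where
  "mpoly_pderiv i p =
     (\<Sum>e\<in>Poly_Mapping.keys p.
        Poly_Mapping.single (e - Poly_Mapping.single i 1)
          (of_nat (Poly_Mapping.lookup e i) * Poly_Mapping.lookup p e))"

definition jacobian_matrix ::
  "(('n::finite, 'a::comm_semiring_1) mpolynomial) ^ 'm::finite
     \<Rightarrow> (('n, 'a) mpolynomial) ^ 'n ^ 'm" where
  "jacobian_matrix F = (\<chi> j i. mpoly_pderiv i (F $ j))"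

definition mpoly_matrix_eval ::
  "(('n::finite, 'a::comm_semiring_1) mpolynomial) ^ 'k::finite ^ 'm::finite
     \<Rightarrow> 'a ^ 'n \<Rightarrow> 'a ^ 'k ^ 'm" where
  "mpoly_matrix_eval A x = (\<chi> j i. mpoly_eval (A $ j $ i) x)"

definition affine_line :: "'a::comm_semiring_1 ^ 'n \<Rightarrow> 'a ^ 'n \<Rightarrow> ('a ^ 'n) set" where
  "affine_line \<beta> \<gamma> = {\<beta> + \<mu> *s \<gamma> | \<mu>. True}"

definition linearly_rectifiable_on_line ::
  "(('n::finite, 'a::idom) mpolynomial) ^ 'm::finite \<Rightarrow> 'a ^ 'n \<Rightarrow> 'a ^ 'n \<Rightarrow> bool" where
  "linearly_rectifiable_on_line F \<beta> \<gamma> \<longleftrightarrow>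
     (\<exists>v :: 'a ^ 'm. (\<Sum>j\<in>UNIV. smult (v $ j) (pderiv (mpoly_on_line (F $ j) \<beta> \<gamma>))) = 1)"

end

theory Submission
  imports Defs
begin

text \<open>
  On the line, the map is a curve \<open>f\<close> in the parameter \<open>T\<close> whose derivative has the form
  \<open>f' = a + b T + c T\<^sup>2\<close> with coefficient vectors \<open>a\<close>, \<open>b\<close>, \<open>c\<close>. A vector \<open>v\<close> as required is a
  linear functional that kills \<open>b\<close> and \<open>c\<close> and maps \<open>a\<close> to \<open>1\<close>, so one exists as soon as \<open>a\<close> does
  not lie in the span of \<open>b\<close> and \<open>c\<close> (\<open>separating_functional\<close>).

  To see that \<open>a\<close> is outside this span, consider the difference quotient (\<open>cubic_chord\<close>)
  \<open>(f s - f t) / (s - t) = a + (s + t) / 2 \<cdot> b + (s\<^sup>2 + s t + t\<^sup>2) / 3 \<cdot> c\<close>.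
  The scalars \<open>s + t\<close> and \<open>s\<^sup>2 + s t + t\<^sup>2 = (s + t)\<^sup>2 - s t\<close> can be prescribed
  independently, because \<open>s\<close> and \<open>t\<close> are the roots of a quadratic with given coefficients
  (\<open>exists_chord_parameters\<close>). Hence, if \<open>a\<close> were a combination of \<open>b\<close> and \<open>c\<close>, some choice of
  \<open>s\<close> and \<open>t\<close> would make the right-hand side vanish. If \<open>s \<noteq> t\<close>, this contradicts injectivity;
  if \<open>s = t\<close>, the right-hand side is \<open>f'(s)\<close>, and this contradicts that the derivative never
  vanishes. By the chain rule (\<open>pderiv_mpoly_on_line\<close>) that derivative is the Jacobian applied to
  the direction of the line.
\<close>

section \<open>Polynomials restricted to a line\<close>

text \<open>
  Additivity of evaluation is not visible from its definition, because the keys of a sum may be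
  fewer than those of the summands; summing over a common superset of the keys removes this
  obstacle.
\<close>

lemma mpoly_eval_superset:
  assumes "finite A" "Poly_Mapping.keys p \<subseteq> A"
  shows "mpoly_eval p x =
    (\<Sum>e\<in>A. Poly_Mapping.lookup p e * (\<Prod>i\<in>UNIV. x $ i ^ Poly_Mapping.lookup e i))"
  unfolding mpoly_eval_def mpoly_subst_def
  by (rule sum.mono_neutral_left) (use assms in \<open>auto simp: in_keys_iff\<close>)

lemma mpoly_eval_add: "mpoly_eval (p + q) x = mpoly_eval p x + mpoly_eval q x"
proof -
  let ?A = "Poly_Mapping.keys p \<union> Poly_Mapping.keys q"
  have "Poly_Mapping.keys (p + q) \<subseteq> ?A"
    by (rule Poly_Mapping.keys_add)
  then show ?thesis
    by (simp add: mpoly_eval_superset[of ?A] lookup_add distrib_right sum.distrib)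
qed

lemma mpoly_eval_sum: "mpoly_eval (\<Sum>a\<in>A. p a) x = (\<Sum>a\<in>A. mpoly_eval (p a) x)"
proof (induction A rule: infinite_finite_induct)
  case (insert a A)
  then show ?case by (simp add: mpoly_eval_add)
qed (simp_all add: mpoly_eval_def mpoly_subst_def)

lemma mpoly_eval_single:
  "mpoly_eval (Poly_Mapping.single e c) x = c * (\<Prod>i\<in>UNIV. x $ i ^ Poly_Mapping.lookup e i)"
  by (subst mpoly_eval_superset[of "{e}"]) auto

lemma poly_mpoly_on_line: "poly (mpoly_on_line p \<beta> \<gamma>) \<mu> = mpoly_eval p (\<beta> + \<mu> *s \<gamma>)"
  by (simp add: mpoly_on_line_def mpoly_eval_def mpoly_subst_def poly_sum poly_prod)

lemma degree_mpoly_on_line_le: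
  fixes p :: "('n::finite, 'a::comm_semiring_1) mpolynomial"
  shows "degree (mpoly_on_line p \<beta> \<gamma>) \<le> total_degree p"
  unfolding mpoly_on_line_def mpoly_subst_def
proof (rule degree_sum_le)
  show "finite (Poly_Mapping.keys p)" by simp
next
  fix e assume e: "e \<in> Poly_Mapping.keys p"
  let ?l = "\<lambda>i. [:\<beta> $ i, \<gamma> $ i:] ^ Poly_Mapping.lookup e i"
  have "degree ([:Poly_Mapping.lookup p e:] * (\<Prod>i\<in>UNIV. ?l i)) \<le> degree (\<Prod>i\<in>UNIV. ?l i)"
    using degree_mult_le[of "[:Poly_Mapping.lookup p e:]" "\<Prod>i\<in>UNIV. ?l i"] by simp
  also have "\<dots> \<le> (\<Sum>i\<in>UNIV. degree (?l i))"
    using degree_prod_sum_le[of UNIV ?l] by (simp add: o_def)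
  also have "\<dots> \<le> monom_degree e"
    unfolding monom_degree_def
  proof (rule sum_mono)
    fix i
    have "degree (?l i) \<le> degree [:\<beta> $ i, \<gamma> $ i:] * Poly_Mapping.lookup e i"
      by (rule degree_power_le)
    also have "\<dots> \<le> 1 * Poly_Mapping.lookup e i"
      by (rule mult_right_mono) auto
    finally show "degree (?l i) \<le> Poly_Mapping.lookup e i" by simp
  qed
  also have "\<dots> \<le> total_degree p"
    unfolding total_degree_def using e by (intro Max_ge) auto
  finally show "degree ([:Poly_Mapping.lookup p e:] * (\<Prod>i\<in>UNIV. ?l i)) \<le> total_degree p" .
qed

text \<open>
  This is the chain rule along a line. Both sides are linear in the polynomial, so it comes down to
  the product rule for one monomial, where the factor of index \<open>i\<close> contributes the partial
  derivative of that index times the slope \<open>\<gamma> $ i\<close>.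
\<close>

lemma pderiv_mpoly_on_line:
  fixes p :: "('n::finite, 'a::idom) mpolynomial"
  shows "poly (pderiv (mpoly_on_line p \<beta> \<gamma>)) \<mu> =
    (\<Sum>i\<in>UNIV. mpoly_eval (mpoly_pderiv i p) (\<beta> + \<mu> *s \<gamma>) * \<gamma> $ i)"
proof -
  define x where "x = \<beta> + \<mu> *s \<gamma>"
  let ?m = "\<lambda>e i. of_nat (Poly_Mapping.lookup e i) * x $ i ^ (Poly_Mapping.lookup e i - 1)
              * (\<Prod>k\<in>UNIV - {i}. x $ k ^ Poly_Mapping.lookup e k)"
  have mono: "(\<Prod>k\<in>UNIV. x $ k ^ Poly_Mapping.lookup (e - Poly_Mapping.single i 1) k) =
      x $ i ^ (Poly_Mapping.lookup e i - 1) * (\<Prod>k\<in>UNIV - {i}. x $ k ^ Poly_Mapping.lookup e k)"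
    for e :: "'n \<Rightarrow>\<^sub>0 nat" and i
    by (subst prod.remove[of _ i]) (auto simp: lookup_minus lookup_single intro!: prod.cong)
  have partial: "mpoly_eval (mpoly_pderiv i p) x =
      (\<Sum>e\<in>Poly_Mapping.keys p. Poly_Mapping.lookup p e * ?m e i)" for i
    by (simp add: mpoly_pderiv_def mpoly_eval_sum mpoly_eval_single mono[unfolded One_nat_def] mult_ac)
  have point: "\<beta> $ i + \<mu> * \<gamma> $ i = x $ i" for i
    by (simp add: x_def)
  have monomial: "poly (pderiv (\<Prod>i\<in>UNIV. [:\<beta> $ i, \<gamma> $ i:] ^ Poly_Mapping.lookup e i)) \<mu> =
      (\<Sum>i\<in>UNIV. ?m e i * \<gamma> $ i)" for e :: "'n \<Rightarrow>\<^sub>0 nat"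
    unfolding pderiv_prod poly_sum
    by (rule sum.cong) (simp_all add: pderiv_power pderiv_pCons poly_prod point)
  have pderiv_sum: "pderiv (\<Sum>e\<in>A. q e) = (\<Sum>e\<in>A. pderiv (q e))"
    for A :: "('n \<Rightarrow>\<^sub>0 nat) set" and q :: "('n \<Rightarrow>\<^sub>0 nat) \<Rightarrow> 'a poly"
    using higher_pderiv_sum[of 1 q A] by simp
  have "poly (pderiv (mpoly_on_line p \<beta> \<gamma>)) \<mu> =
      (\<Sum>e\<in>Poly_Mapping.keys p. Poly_Mapping.lookup p e * (\<Sum>i\<in>UNIV. ?m e i * \<gamma> $ i))"
    by (simp add: mpoly_on_line_def mpoly_subst_def pderiv_sum poly_sum pderiv_smult monomial)
  also have "\<dots> = (\<Sum>i\<in>UNIV. mpoly_eval (mpoly_pderiv i p) x * \<gamma> $ i)"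
    by (simp add: partial sum_distrib_left sum_distrib_right mult.assoc)
      (rule sum.swap)
  finally show ?thesis by (simp add: x_def)
qed

section \<open>Difference quotients of cubics\<close>

lemma poly_degree_le_3:
  fixes p :: "'a::comm_semiring_1 poly"
  assumes "degree p \<le> 3"
  shows "poly p t = coeff p 0 + coeff p 1 * t + coeff p 2 * t ^ 2 + coeff p 3 * t ^ 3"
proof -
  have "poly p t = (\<Sum>i\<le>3. coeff p i * t ^ i)"
    unfolding poly_altdef
    by (rule sum.mono_neutral_left) (use assms in \<open>auto simp: coeff_eq_0\<close>)
  then show ?thesis
    by (simp add: numeral_3_eq_3 numeral_2_eq_2)
qed

lemma cubic_chord:
  fixes p :: "'a::field_char_0 poly"
  assumes "degree p \<le> 3"
  shows "poly p s - poly p t = (s - t) *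
    (coeff (pderiv p) 0 + (s + t) / 2 * coeff (pderiv p) 1
      + (s\<^sup>2 + s * t + t\<^sup>2) / 3 * coeff (pderiv p) 2)"
proof -
  have coeffs: "coeff (pderiv p) 0 = coeff p 1" "coeff (pderiv p) 1 = 2 * coeff p 2"
    "coeff (pderiv p) 2 = 3 * coeff p 3"
    by (simp_all add: coeff_pderiv numeral_2_eq_2 numeral_3_eq_3)
  have "(s - t) * (coeff p 1 + (s + t) / 2 * (2 * coeff p 2)
      + (s\<^sup>2 + s * t + t\<^sup>2) / 3 * (3 * coeff p 3)) =
    (s - t) * (coeff p 1 + (s + t) * coeff p 2 + (s\<^sup>2 + s * t + t\<^sup>2) * coeff p 3)"
    by simp
  then show ?thesis
    unfolding poly_degree_le_3[OF assms] coeffs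
    by (simp only:) (simp add: power2_eq_square power3_eq_cube algebra_simps)
qed

lemma poly_pderiv_cubic:
  fixes p :: "'a::field_char_0 poly"
  assumes "degree p \<le> 3"
  shows "poly (pderiv p) t = coeff (pderiv p) 0 + t * coeff (pderiv p) 1 + t\<^sup>2 * coeff (pderiv p) 2"
proof -
  have deg: "degree (pderiv p) \<le> 2"
    using assms by (simp add: degree_pderiv)
  then have "coeff (pderiv p) 3 = 0"
    by (intro coeff_eq_0) simp
  with deg show ?thesis
    by (simp add: poly_degree_le_3 mult_ac)
qed

text \<open>
  The parameters are the roots of the quadratic with root sum \<open>2 x\<close> and root product
  \<open>(2 x)\<^sup>2 - 3 y\<close>.
\<close>

lemma exists_chord_parameters:
  fixes x y :: complex
  obtains s t where "(s + t) / 2 = x" "(s\<^sup>2 + s * t + t\<^sup>2) / 3 = y"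
proof
  define w where "w = csqrt (3 * (y - x\<^sup>2))"
  have w: "w\<^sup>2 = 3 * (y - x\<^sup>2)" by (simp add: w_def)
  show "((x + w) + (x - w)) / 2 = x" by simp
  have "(x + w)\<^sup>2 + (x + w) * (x - w) + (x - w)\<^sup>2 = 3 * x\<^sup>2 + w\<^sup>2"
    by (simp add: power2_eq_square algebra_simps)
  then show "((x + w)\<^sup>2 + (x + w) * (x - w) + (x - w)\<^sup>2) / 3 = y"
    by (simp add: w)
qed

section \<open>Rectification of a cubic curve\<close>

text \<open>
  A vector outside a subspace stays independent when added to a basis of the subspace, so a linear
  map may be prescribed to vanish on the basis and to send the vector to the all-ones vector; any
  coordinate of that map is a functional of the form sought.
\<close>

lemma separating_functional:
  fixes a :: "'a::field ^ 'm::finite"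
  assumes "a \<notin> vec.span S"
  obtains v :: "'a ^ 'm" where "(\<Sum>j\<in>UNIV. v $ j * a $ j) = 1"
    and "\<And>x. x \<in> S \<Longrightarrow> (\<Sum>j\<in>UNIV. v $ j * x $ j) = 0"
proof -
  obtain B where B: "B \<subseteq> S" "vec.independent B" "S \<subseteq> vec.span B"
    using vec.maximal_independent_subset[of S] by metis
  have aB: "a \<notin> vec.span B"
    using assms B(1) vec.span_mono by blast
  then have "vec.independent (insert a B)"
    using B(2) vec.independent_insertI by blast
  then obtain g where g: "Vector_Spaces.linear (*s) (*s) g"
    and gv: "\<And>x. x \<in> insert a B \<Longrightarrow> g x = (if x = a then vec 1 else (0 :: 'a ^ 'm))"
    using vec.linear_independent_extend[of "insert a B" "\<lambda>x. if x = a then vec 1 else 0"]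
    by blast
  obtain k :: 'm where "k \<in> UNIV" by blast
  define v where "v = matrix g $ k"
  have gk: "g x $ k = (\<Sum>j\<in>UNIV. v $ j * x $ j)" for x
  proof -
    have "g x $ k = (matrix g *v x) $ k"
      by (simp only: matrix_works[OF g])
    then show ?thesis
      by (simp only: v_def matrix_vector_mult_def vec_lambda_beta)
  qed
  show ?thesis
  proof
    show "(\<Sum>j\<in>UNIV. v $ j * a $ j) = 1"
      using gv[of a] by (simp flip: gk)
  next
    fix x assume "x \<in> S"
    then have "x \<in> vec.span B" using B(3) by blast
    moreover have "g b = 0" if "b \<in> B" for b
      using gv[of b] that aB vec.span_base by auto
    ultimately have "g x = 0"
      using vec.linear_eq_0_on_span[OF g] by blast
    then show "(\<Sum>j\<in>UNIV. v $ j * x $ j) = 0"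
      by (simp flip: gk)
  qed
qed

text \<open>
  The bound \<open>3\<close> on the degree is what makes two parameters \<open>s\<close>, \<open>t\<close> enough: the derivative has only
  two coefficient vectors besides the constant one, and each of the two scalars in front of them in
  the difference quotient can be given any value.
\<close>

lemma immersed_injective_cubic_curve_rectifiable:
  fixes f :: "'m::finite \<Rightarrow> complex poly"
  assumes deg: "\<And>j. degree (f j) \<le> 3"
    and inj: "\<And>s t. (\<And>j. poly (f j) s = poly (f j) t) \<Longrightarrow> s = t"
    and immersed: "\<And>t. \<exists>j. poly (pderiv (f j)) t \<noteq> 0"
  obtains v :: "complex ^ 'm" where "(\<Sum>j\<in>UNIV. smult (v $ j) (pderiv (f j))) = 1"
proof -
  define d where "d = (\<lambda>k. \<chi> j. coeff (pderiv (f j)) k)"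
  have "d 0 \<notin> vec.span {d 1, d 2}"
  proof
    assume "d 0 \<in> vec.span {d 1, d 2}"
    then obtain x y where "d 0 - x *s d 1 - y *s d 2 = 0"
      by (auto simp: vec.span_insert)
    then have dep: "coeff (pderiv (f j)) 0 - x * coeff (pderiv (f j)) 1
        - y * coeff (pderiv (f j)) 2 = 0" for j
      by (simp add: d_def vec_eq_iff)
    \<comment> \<open>For these parameters the difference quotient of \<open>f j\<close> is the left-hand side of \<open>dep\<close>.\<close>
    obtain s t where st: "(s + t) / 2 = - x" "(s\<^sup>2 + s * t + t\<^sup>2) / 3 = - y"
      by (rule exists_chord_parameters)
    have "poly (f j) s = poly (f j) t" for j
      using cubic_chord[OF deg, of j s t] dep[of j] unfolding st by simp
    then have "s = t" by (rule inj)
    then have "t = - x" "t\<^sup>2 = - y"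
      using st by (simp_all add: power2_eq_square)
    then have "poly (pderiv (f j)) t = 0" for j
      unfolding poly_pderiv_cubic[OF deg] using dep[of j] by simp
    then show False using immersed by blast
  qed
  then obtain v where v: "(\<Sum>j\<in>UNIV. v $ j * d 0 $ j) = 1"
    "(\<Sum>j\<in>UNIV. v $ j * d 1 $ j) = 0" "(\<Sum>j\<in>UNIV. v $ j * d 2 $ j) = 0"
    by (rule separating_functional) blast
  have "coeff (\<Sum>j\<in>UNIV. smult (v $ j) (pderiv (f j))) k = coeff 1 k" for k
  proof -
    consider "k = 0" | "k = 1" | "k = 2" | "k \<ge> 3" by linarith
    then show ?thesis
    proof cases
      case 4
      then have "coeff (f j) (Suc k) = 0" for j
        using deg[of j] by (intro coeff_eq_0) linarith
      with 4 show ?thesis by (simp add: coeff_sum coeff_pderiv)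
    qed (use v in \<open>simp_all add: coeff_sum d_def\<close>)
  qed
  then show ?thesis using that by (blast intro: poly_eqI)
qed

theorem proposition2p8:
  fixes F :: "(('n::finite, complex) mpolynomial) ^ 'm::finite"
    and \<beta> \<gamma> :: "complex ^ 'n"
  assumes "polymap_degree F \<le> 3"
    and "\<gamma> \<noteq> 0"
    and "inj_on (polymap_eval F) (affine_line \<beta> \<gamma>)"
    and "\<forall>\<alpha>\<in>affine_line \<beta> \<gamma>. mpoly_matrix_eval (jacobian_matrix F) \<alpha> *v \<gamma> \<noteq> 0"
  shows "linearly_rectifiable_on_line F \<beta> \<gamma>"
proof -
  let ?f = "\<lambda>j. mpoly_on_line (F $ j) \<beta> \<gamma>"
  have on_line: "\<beta> + \<mu> *s \<gamma> \<in> affine_line \<beta> \<gamma>" for \<mu>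
    by (auto simp: affine_line_def)
  have deg: "degree (?f j) \<le> 3" for j
  proof -
    have "total_degree (F $ j) \<le> polymap_degree F"
      by (auto simp: polymap_degree_def)
    then show ?thesis
      using degree_mpoly_on_line_le[of "F $ j" \<beta> \<gamma>] assms(1) by linarith
  qed
  have inj: "s = t" if "\<And>j. poly (?f j) s = poly (?f j) t" for s t
  proof -
    have "polymap_eval F (\<beta> + s *s \<gamma>) = polymap_eval F (\<beta> + t *s \<gamma>)"
      using that by (simp add: polymap_eval_def poly_mpoly_on_line)
    then have "\<beta> + s *s \<gamma> = \<beta> + t *s \<gamma>"
      using assms(3) on_line by (auto dest: inj_onD)
    then show "s = t"
      using assms(2) by auto
  qed
  have immersed: "\<exists>j. poly (pderiv (?f j)) t \<noteq> 0" for t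
  proof -
    have "mpoly_matrix_eval (jacobian_matrix F) (\<beta> + t *s \<gamma>) *v \<gamma> \<noteq> 0"
      using assms(4) on_line by blast
    moreover have "(mpoly_matrix_eval (jacobian_matrix F) (\<beta> + t *s \<gamma>) *v \<gamma>) $ j
        = poly (pderiv (?f j)) t" for j
      by (simp add: matrix_vector_mult_def mpoly_matrix_eval_def jacobian_matrix_def
          pderiv_mpoly_on_line)
    ultimately show ?thesis by (auto simp: vec_eq_iff)
  qed
  obtain v :: "complex ^ 'm" where "(\<Sum>j\<in>UNIV. smult (v $ j) (pderiv (?f j))) = 1"
    using immersed_injective_cubic_curve_rectifiable[of ?f] deg inj immersed by blast
  then show ?thesis
    unfolding linearly_rectifiable_on_line_def by blast
qed

end
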